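(* Let $\Psi^0,\Psi^1,\Psi^2$ be formal series of the form $$\Psi^0=\lambda+\sum_{n=1}^\infty \Psi^0_n(\mathbf t^1,\mathbf t^2)\lambda^{-n},\qquad \Psi^k=\sum_{n=0}^\infty t^k_n(\Psi^0)^n+\sum_{n=1}^\infty\Psi^k_n(\mathbf t^1,\mathbf t^2)(\Psi^0)^{-n}\quad(k=1,2),$$ depending on two infinite sets of variables ("times") $\mathbf t^1=(t^1_0,\dots,t^1_n,\dots)$, $\mathbf t^2=(t^2_0,\dots,t^2_n,\dots)$. Denote $x=t^1_0$, $y=t^2_0$, $\mathbf\Psi=(\Psi^0,\Psi^1,\Psi^2)^{T}$, $\partial^1_n=\partial/\partial t^1_n$, $\partial^2_n=\partial/\partial t^2_n$, $\partial_0=\partial_\lambda$, $\partial_1=\partial_x$, $\partial_2=\partial_y$, and $$J=\begin{pmatrix}\Psi^0_\lambda&\Psi^1_\lambda&\Psi^2_\lambda\\ \Psi^0_x&\Psi^1_x&\Psi^2_x\\ \Psi^0_y&\Psi^1_y&\Psi^2_y\end{pmatrix}.$$ Then the relation $$(\mathrm d\Psi^0\wedge\mathrm d\Psi^1\wedge\mathrm d\Psi^2)_-=0,$$ where the differential $\mathrm d$ includes both the times and the spectral variable $\lambda$, is equivalent to the set of equations $$\partial^1_n\mathbf\Psi=\sum_{i=0,1,2}\big(J^{-1}_{1i}(\Psi^0)^n\big)_+\,\partial_i\mathbf\Psi,\qquad \partial^2_n\mathbf\Psi=\sum_{i=0,1,2}\big(J^{-1}_{2i}(\Psi^0)^n\big)_+\,\partial_i\mathbf\Psi\qquad(n\ge0),$$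 $$\det J=1 .$$
   Context: Projectors: $\big(\sum_{n=-\infty}^{\infty}u_n\lambda^n\big)_+=\sum_{n=0}^{\infty}u_n\lambda^n$ and $\big(\sum_{n=-\infty}^{\infty}u_n\lambda^n\big)_-=\sum_{n=-\infty}^{-1}u_n\lambda^n$; applied to a differential form they act on its coefficients. Differential: $\mathrm df=\sum_{n=0}^\infty\partial^1_nf\,\mathrm dt^1_n+\sum_{n=0}^\infty\partial^2_nf\,\mathrm dt^2_n+\partial_\lambda f\,\mathrm d\lambda$. Subscripts $\lambda,x,y$ denote partial derivatives. $J^{-1}_{ai}$ is the entry of the inverse matrix $J^{-1}$ in row $a$ and column $i$, rows and columns being indexed by $0,1,2$. *)

theory Defs
  imports "HOL-Analysis.Analysis" "HOL-Computational_Algebra.Formal_Laurent_Series"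
    "HOL-Library.Multiset"
begin

section \<open>Formal power series in arbitrarily many variables\<close>

text \<open>A monomial in the variables \<open>'v\<close> is a finite multiset of variables; a power series is an
  arbitrary assignment of coefficients to monomials.\<close>

typedef ('v, 'b) mps = "UNIV :: ('v multiset \<Rightarrow> 'b) set"
  morphisms mps_nth Abs_mps
  by simp

setup_lifting type_definition_mps

lemma mps_eqI: "(\<And>M. mps_nth f M = mps_nth g M) \<Longrightarrow> f = g"
  by transfer auto

lemma finite_submultisets: "finite {A. A \<subseteq># M}"
proof (induction M)
  case empty
  then show ?case by simp
next
  case (add x M)
  have "A \<in> {A. A \<subseteq># M} \<union> add_mset x ` {A. A \<subseteq># M}" if "A \<subseteq># add_mset x M" for A
  proof (cases "x \<in># A")
    case True
    then obtain B where B: "A = add_mset x B" by (meson multi_member_split)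
    with that show ?thesis by auto
  next
    case False
    with that have "A \<subseteq># M"
      by (metis diff_single_trivial subset_eq_diff_conv add_mset_add_single)
    then show ?thesis by simp
  qed
  then have "{A. A \<subseteq># add_mset x M} \<subseteq> {A. A \<subseteq># M} \<union> add_mset x ` {A. A \<subseteq># M}"
    by blast
  with add.IH show ?case by (meson finite_UnI finite_imageI finite_subset)
qed

lemma diff_diff_cancel_submultiset: "A \<subseteq># M \<Longrightarrow> M - (M - A) = A"
  by (metis add_diff_cancel_right' subset_mset.add_diff_inverse)

lemma diff_diff_submultiset: "B \<subseteq># A \<Longrightarrow> M - B - (A - B) = M - A"
  by (simp add: diff_diff_add_mset subset_mset.add_diff_inverse)

instantiation mps :: (type, comm_ring_1) comm_ring_1
begin

lift_definition zero_mps :: "('a, 'b) mps" is "\<lambda>M. 0" .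
lift_definition one_mps :: "('a, 'b) mps" is "\<lambda>M. if M = {#} then 1 else 0" .
lift_definition plus_mps :: "('a, 'b) mps \<Rightarrow> ('a, 'b) mps \<Rightarrow> ('a, 'b) mps"
  is "\<lambda>f g M. f M + g M" .
lift_definition minus_mps :: "('a, 'b) mps \<Rightarrow> ('a, 'b) mps \<Rightarrow> ('a, 'b) mps"
  is "\<lambda>f g M. f M - g M" .
lift_definition uminus_mps :: "('a, 'b) mps \<Rightarrow> ('a, 'b) mps" is "\<lambda>f M. - f M" .
lift_definition times_mps :: "('a, 'b) mps \<Rightarrow> ('a, 'b) mps \<Rightarrow> ('a, 'b) mps"
  is "\<lambda>f g M. \<Sum>A | A \<subseteq># M. f A * g (M - A)" .

instance
proof
  fix f g h :: "('a, 'b) mps"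
  show "f + g + h = f + (g + h)" by transfer (simp add: add.assoc)
  show "f + g = g + f" by transfer (simp add: add.commute)
  show "0 + f = f" by transfer simp
  show "- f + f = 0" by transfer simp
  show "f - g = f + - g" by transfer simp
  show "(0 :: ('a, 'b) mps) \<noteq> 1" by transfer (metis zero_neq_one)
  show "(f + g) * h = f * h + g * h"
    by transfer (simp add: distrib_right sum.distrib)
  show "f * g = g * f"
  proof (transfer, rule ext)
    fix f g :: "'a multiset \<Rightarrow> 'b" and M
    show "(\<Sum>A | A \<subseteq># M. f A * g (M - A)) = (\<Sum>A | A \<subseteq># M. g A * f (M - A))"
      by (rule sum.reindex_bij_witness[of _ "\<lambda>A. M - A" "\<lambda>A. M - A"])
        (auto simp: mult.commute diff_diff_cancel_submultiset)
  qed
  show "1 * f = f"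
  proof (transfer, rule ext)
    fix f :: "'a multiset \<Rightarrow> 'b" and M
    have "(\<Sum>A | A \<subseteq># M. (if A = {#} then 1 else 0) * f (M - A))
        = (\<Sum>A \<in> {{#}}. (if A = {#} then 1 else 0) * f (M - A))"
      by (rule sum.mono_neutral_right) (auto simp: finite_submultisets)
    then show "(\<Sum>A | A \<subseteq># M. (if A = {#} then 1 else 0) * f (M - A)) = f M" by simp
  qed
  show "f * g * h = f * (g * h)"
  proof (transfer, rule ext)
    fix f g h :: "'a multiset \<Rightarrow> 'b" and M
    have "(\<Sum>A | A \<subseteq># M. (\<Sum>B | B \<subseteq># A. f B * g (A - B)) * h (M - A))
        = (\<Sum>(A, B) \<in> (SIGMA A : {A. A \<subseteq># M}. {B. B \<subseteq># A}). f B * g (A - B) * h (M - A))"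
      by (simp add: sum_distrib_right sum.Sigma finite_submultisets)
    also have "\<dots> = (\<Sum>(B, C) \<in> (SIGMA B : {B. B \<subseteq># M}. {C. C \<subseteq># M - B}).
        f B * (g C * h (M - B - C)))"
      by (rule sum.reindex_bij_witness[of _ "\<lambda>(B, C). (B + C, B)" "\<lambda>(A, B). (B, A - B)"])
        (auto simp: mult.assoc subset_mset.le_diff_conv2 ac_simps diff_diff_submultiset
          subset_mset.add_diff_inverse subset_eq_diff_conv intro: subset_mset.order_trans)
    also have "\<dots> = (\<Sum>B | B \<subseteq># M. f B * (\<Sum>C | C \<subseteq># M - B. g C * h (M - B - C)))"
      by (simp add: sum_distrib_left sum.Sigma finite_submultisets)
    finally show "(\<Sum>A | A \<subseteq># M. (\<Sum>B | B \<subseteq># A. f B * g (A - B)) * h (M - A))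
        = (\<Sum>A | A \<subseteq># M. f A * (\<Sum>B | B \<subseteq># M - A. g B * h (M - A - B)))" .
  qed
qed

end

lift_definition mps_const :: "'b::zero \<Rightarrow> ('v, 'b) mps"
  is "\<lambda>c M. if M = {#} then c else 0" .

lift_definition mps_var :: "'v \<Rightarrow> ('v, 'b::zero_neq_one) mps"
  is "\<lambda>v M. if M = {#v#} then 1 else 0" .

lift_definition mps_map :: "('b \<Rightarrow> 'c) \<Rightarrow> ('v, 'b) mps \<Rightarrow> ('v, 'c) mps"
  is "\<lambda>\<phi> f M. \<phi> (f M)" .

lift_definition mps_deriv :: "'v \<Rightarrow> ('v, 'b::semiring_1) mps \<Rightarrow> ('v, 'b) mps"
  is "\<lambda>v f M. of_nat (count M v + 1) * f (add_mset v M)" .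

text \<open>Coefficientwise convergence, each coefficient converging in the topology of \<open>'b\<close>.\<close>

definition mps_sums ::
    "(nat \<Rightarrow> ('v, 'b::{topological_space, comm_monoid_add}) mps) \<Rightarrow> ('v, 'b) mps \<Rightarrow> bool"
    (infixr "mps'_sums" 80)
  where "f mps_sums S \<longleftrightarrow> (\<forall>M. (\<lambda>n. mps_nth (f n) M) sums mps_nth S M)"

text \<open>The value is meaningful for units only.\<close>

definition ring_inverse :: "'r::comm_ring_1 \<Rightarrow> 'r"
  where "ring_inverse f = (THE g. f * g = 1)"


section \<open>Series in the spectral variable and the times\<close>

text \<open>\<open>T1 n\<close> and \<open>T2 n\<close> are the times \<open>t\<^sup>1\<^sub>n\<close> and \<open>t\<^sup>2\<^sub>n\<close>.\<close>

datatype time = T1 nat | T2 nat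

datatype coordinate = Spectral | Time time

text \<open>
  Functions of the times are formal power series in all of them over a field \<open>'a\<close>.  A formal
  series in \<open>\<lambda>\<close> depending on the times is a power series in the times whose coefficients are Laurent
  series in \<open>1/\<lambda>\<close>; the library variable \<open>fls_X\<close> stands for \<open>1/\<lambda>\<close>, so that index \<open>k\<close> of an element
  of \<open>'a fls\<close> is the coefficient of \<open>\<lambda>\<close> to the power \<open>-k\<close>.  Only the coefficient of each separate
  monomial in the times is bounded above in \<open>\<lambda>\<close>.  So the series as a whole may extend infinitely
  in both directions, as \<open>\<Sum>n. t\<^sub>n \<lambda>\<^sup>n\<close> does, and yet these series form a ring.
\<close>

type_synonym 'a times_series = "(time, 'a) mps"
type_synonym 'a lseries = "(time, 'a fls) mps"

definition of_times :: "'a::zero times_series \<Rightarrow> 'a lseries"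
  where "of_times = mps_map fls_const"

definition lam :: "'a::comm_ring_1 lseries"
  where "lam = mps_const fls_X_inv"

definition lam_inv :: "'a::comm_ring_1 lseries"
  where "lam_inv = mps_const fls_X"

lift_definition fls_lam_nonneg :: "'a::zero fls \<Rightarrow> 'a fls"
  is "\<lambda>f k. if k \<le> 0 then f k else 0"
  by (auto elim: eventually_mono)

lift_definition fls_lam_neg :: "'a::zero fls \<Rightarrow> 'a fls"
  is "\<lambda>f k. if 1 \<le> k then f k else 0"
  by (auto elim: eventually_mono)

definition plus_part :: "'a::zero lseries \<Rightarrow> 'a lseries"
  where "plus_part = mps_map fls_lam_nonneg"

definition minus_part :: "'a::zero lseries \<Rightarrow> 'a lseries"
  where "minus_part = mps_map fls_lam_neg"

text \<open>With \<open>X = 1/\<lambda>\<close> one has \<open>d/d\<lambda> = - X\<^sup>2 d/dX\<close>.\<close>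

fun partial :: "coordinate \<Rightarrow> 'a::comm_ring_1 lseries \<Rightarrow> 'a lseries" where
  "partial Spectral f = mps_map (\<lambda>u. - (fls_X ^ 2 * fls_deriv u)) f"
| "partial (Time v) f = mps_deriv v f"

lemma partial_Spectral_nth:
  "fls_nth (mps_nth (partial Spectral f) M) (- n)
     = of_int (n + 1) * fls_nth (mps_nth f M) (- (n + 1))"
  by (simp add: mps_map.rep_eq fls_X_power_times_conv_shift algebra_simps)


section \<open>Differential forms\<close>

text \<open>
  A form of degree \<open>p\<close> in the coordinates \<open>z\<close> (\<open>\<lambda>\<close> and all times) is given by its antisymmetric
  components: the value at \<open>a\<^sub>1, \<dots>, a\<^sub>p\<close> is the coefficient of \<open>dz\<^sub>a\<^sub>1 \<and> \<dots> \<and> dz\<^sub>a\<^sub>p\<close>.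
\<close>

type_synonym 'a form1 = "coordinate \<Rightarrow> 'a lseries"
type_synonym 'a form2 = "coordinate \<Rightarrow> coordinate \<Rightarrow> 'a lseries"
type_synonym 'a form3 = "coordinate \<Rightarrow> coordinate \<Rightarrow> coordinate \<Rightarrow> 'a lseries"

definition differential :: "'a::comm_ring_1 lseries \<Rightarrow> 'a form1"
  where "differential f = (\<lambda>a. partial a f)"

definition wedge11 :: "'a::comm_ring_1 form1 \<Rightarrow> 'a form1 \<Rightarrow> 'a form2"
  where "wedge11 \<alpha> \<beta> = (\<lambda>a b. \<alpha> a * \<beta> b - \<alpha> b * \<beta> a)"

definition wedge21 :: "'a::comm_ring_1 form2 \<Rightarrow> 'a form1 \<Rightarrow> 'a form3"
  where "wedge21 \<omega> \<gamma> = (\<lambda>a b c. \<omega> a b * \<gamma> c - \<omega> a c * \<gamma> b + \<omega> b c * \<gamma> a)"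

definition minus_part_form3 :: "'a::comm_ring_1 form3 \<Rightarrow> 'a form3"
  where "minus_part_form3 \<omega> = (\<lambda>a b c. minus_part (\<omega> a b c))"


section \<open>The Jacobian matrix\<close>

text \<open>The numeral type \<open>3\<close> has exactly the elements \<open>0, 1, 2\<close>.\<close>

definition base_coordinate :: "3 \<Rightarrow> coordinate" where
  "base_coordinate i =
     (if i = 0 then Spectral else if i = 1 then Time (T1 0) else Time (T2 0))"

definition partial_vec :: "coordinate \<Rightarrow> 'a::comm_ring_1 lseries ^ 3 \<Rightarrow> 'a lseries ^ 3"
  where "partial_vec a \<Psi> = (\<chi> j. partial a (\<Psi> $ j))"

definition jacobi_matrix :: "'a::comm_ring_1 lseries ^ 3 \<Rightarrow> 'a lseries ^ 3 ^ 3"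
  where "jacobi_matrix \<Psi> = (\<chi> i j. partial (base_coordinate i) (\<Psi> $ j))"

end

theory Submission
  imports Defs
begin

text \<open>
  Modulo \<open>d\<Psi>\<^sup>0\<close>, the form \<open>d\<Psi>\<^sup>k\<close> is \<open>\<Sum>n. (\<Psi>\<^sup>0)\<^sup>n dt\<^sup>k\<^sub>n\<close> plus negative powers of \<open>\<lambda>\<close>, because the
  part of \<open>\<Psi>\<^sup>k\<close> growing in \<open>\<lambda>\<close> depends on \<open>\<lambda>\<close> only through \<open>\<Psi>\<^sup>0\<close>.  Subtracting multiples of \<open>d\<Psi>\<^sup>0\<close>
  does not change \<open>\<Omega> = d\<Psi>\<^sup>0 \<and> d\<Psi>\<^sup>1 \<and> d\<Psi>\<^sup>2\<close>, so \<open>det J = 1\<close> up to negative powers always holds.  If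
  \<open>\<Omega>\<close> has no negative powers, then \<open>det J = 1\<close>, and by Cramer's rule \<open>\<partial>\<^sup>k\<^sub>n\<Psi>\<close> expands in
  \<open>\<partial>\<^sub>0\<Psi>, \<partial>\<^sub>1\<Psi>, \<partial>\<^sub>2\<Psi>\<close> with components of \<open>\<Omega>\<close> as coefficients; these differ from
  \<open>J\<^sup>-\<^sup>1\<^sub>k\<^sub>i (\<Psi>\<^sup>0)\<^sup>n\<close> by negative powers only.  Conversely the evolution equations make every
  component of \<open>\<Omega>\<close> a polynomial combination of \<open>det J = 1\<close> and series without negative powers.
\<close>

section \<open>Derivations of power series\<close>

lemma mps_nth_sum: "mps_nth (\<Sum>i\<in>A. f i) M = (\<Sum>i\<in>A. mps_nth (f i) M)"
  by (induction A rule: infinite_finite_induct) (simp_all add: zero_mps.rep_eq plus_mps.rep_eq)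

lemma mps_nth_const_times:
  "mps_nth (mps_const c * f) M = c * mps_nth (f :: ('v, 'b::comm_ring_1) mps) M"
proof -
  have "(\<Sum>A | A \<subseteq># M. (if A = {#} then c else 0) * mps_nth f (M - A))
      = (\<Sum>A \<in> {{#}}. (if A = {#} then c else 0) * mps_nth f (M - A))"
    by (rule sum.mono_neutral_right) (auto simp: finite_submultisets)
  then show ?thesis by (simp add: times_mps.rep_eq mps_const.rep_eq)
qed

lemma mps_nth_var_times:
  "mps_nth (mps_var v * f) M
     = (if v \<in># M then mps_nth (f :: ('v, 'b::comm_ring_1) mps) (M - {#v#}) else 0)"
proof -
  have "(\<Sum>A | A \<subseteq># M. (if A = {#v#} then 1 else 0) * mps_nth f (M - A))
      = (\<Sum>A \<in> (if v \<in># M then {{#v#}} else {}).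
          (if A = {#v#} then 1 else 0) * mps_nth f (M - A))"
    by (rule sum.mono_neutral_right) (auto simp: finite_submultisets)
  then show ?thesis by (simp add: times_mps.rep_eq mps_var.rep_eq)
qed

text \<open>The exponent of \<open>v\<close> in a monomial is the sum of its exponents in the two
  factors. Terms weighted by the first exponent give one Leibniz summand, those weighted by the
  second give the other.\<close>

lemma mps_deriv_mult:
  "mps_deriv v (f * g) = mps_deriv v f * g + f * mps_deriv v (g :: ('v, 'b::comm_ring_1) mps)"
proof (rule mps_eqI)
  fix M
  let ?N = "add_mset v M"
  let ?f = "mps_nth f" and ?g = "mps_nth g"
  have split: "(\<Sum>A | A \<subseteq># ?N. of_nat (count M v + 1) * (?f A * ?g (?N - A)))
      = (\<Sum>A | A \<subseteq># ?N. of_nat (count A v) * (?f A * ?g (?N - A)))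
        + (\<Sum>A | A \<subseteq># ?N. of_nat (count (?N - A) v) * (?f A * ?g (?N - A)))"
  proof -
    have "count M v + 1 = count A v + count (?N - A) v" if "A \<subseteq># ?N" for A
      using mset_subset_eq_count[OF that, of v] by simp
    then have "of_nat (count M v + 1) * (?f A * ?g (?N - A))
        = of_nat (count A v) * (?f A * ?g (?N - A))
          + of_nat (count (?N - A) v) * (?f A * ?g (?N - A))" if "A \<subseteq># ?N" for A
      using that by (simp only: distrib_right of_nat_add)
    then show ?thesis by (simp add: sum.distrib[symmetric] del: of_nat_add)
  qed
  \<comment> \<open>The weight kills every \<open>A\<close> without \<open>v\<close>, so a copy of
    \<open>v\<close> can be split off from the remaining ones.\<close>
  have "(\<Sum>A | A \<subseteq># ?N. of_nat (count A v) * (?f A * ?g (?N - A)))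
      = (\<Sum>A \<in> add_mset v ` {A. A \<subseteq># M}. of_nat (count A v) * (?f A * ?g (?N - A)))"
  proof (rule sum.mono_neutral_right)
    show "\<forall>A\<in>{A. A \<subseteq># ?N} - add_mset v ` {A. A \<subseteq># M}.
        of_nat (count A v) * (?f A * ?g (?N - A)) = 0"
    proof
      fix A assume A: "A \<in> {A. A \<subseteq># ?N} - add_mset v ` {A. A \<subseteq># M}"
      have "v \<notin># A"
      proof
        assume "v \<in># A"
        then obtain B where "A = add_mset v B" by (meson multi_member_split)
        with A show False by auto
      qed
      then show "of_nat (count A v) * (?f A * ?g (?N - A)) = 0"
        by (simp add: not_in_iff)
    qed
  qed (auto simp: finite_submultisets)
  also have "\<dots> = mps_nth (mps_deriv v f * g) M"
    by (subst sum.reindex) (auto simp: times_mps.rep_eq mps_deriv.rep_eq inj_on_def mult.assoc)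
  finally have 1: "(\<Sum>A | A \<subseteq># ?N. of_nat (count A v) * (?f A * ?g (?N - A)))
      = mps_nth (mps_deriv v f * g) M" .
  \<comment> \<open>Now the weight kills every \<open>A\<close> that exhausts the copies of
    \<open>v\<close> in \<open>?N\<close>; the others are submultisets of \<open>M\<close>.\<close>
  have "(\<Sum>A | A \<subseteq># ?N. of_nat (count (?N - A) v) * (?f A * ?g (?N - A)))
      = (\<Sum>A | A \<subseteq># M. of_nat (count (?N - A) v) * (?f A * ?g (?N - A)))"
  proof (rule sum.mono_neutral_right)
    show "{A. A \<subseteq># M} \<subseteq> {A. A \<subseteq># ?N}"
      by (auto intro: subset_mset.order_trans)
    show "\<forall>A\<in>{A. A \<subseteq># ?N} - {A. A \<subseteq># M}. of_nat (count (?N - A) v) * (?f A * ?g (?N - A)) = 0"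
    proof
      fix A assume A: "A \<in> {A. A \<subseteq># ?N} - {A. A \<subseteq># M}"
      have "v \<notin># ?N - A"
      proof
        assume v: "v \<in># ?N - A"
        have "count A u \<le> count M u" for u
          using A v mset_subset_eq_count[of A ?N u]
          by (cases "u = v") (auto simp: in_diff_count)
        with A show False by (auto simp: subseteq_mset_def)
      qed
      then show "of_nat (count (?N - A) v) * (?f A * ?g (?N - A)) = 0"
        by (metis mult_zero_left not_in_iff of_nat_0)
    qed
  qed (simp add: finite_submultisets)
  also have "\<dots> = mps_nth (f * mps_deriv v g) M"
    unfolding times_mps.rep_eq mps_deriv.rep_eq
  proof (rule sum.cong)
    fix A assume "A \<in> {A. A \<subseteq># M}"
    then have "?N - A = add_mset v (M - A)"
      by (metis add_mset_add_single mem_Collect_eq subset_mset.diff_add_assoc2)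
    then show "of_nat (count (?N - A) v) * (?f A * ?g (?N - A))
        = ?f A * (of_nat (count (M - A) v + 1) * ?g (add_mset v (M - A)))"
      by (simp add: ac_simps)
  qed simp
  finally have 2: "(\<Sum>A | A \<subseteq># ?N. of_nat (count (?N - A) v) * (?f A * ?g (?N - A)))
      = mps_nth (f * mps_deriv v g) M" .
  show "mps_nth (mps_deriv v (f * g)) M = mps_nth (mps_deriv v f * g + f * mps_deriv v g) M"
    unfolding plus_mps.rep_eq 1[symmetric] 2[symmetric] split[symmetric]
    by (simp add: mps_deriv.rep_eq times_mps.rep_eq sum_distrib_left del: of_nat_add)
qed

lemma mps_map_add:
  assumes "\<And>x y. \<phi> (x + y) = \<phi> x + \<phi> y"
  shows "mps_map \<phi> (f + g) = mps_map \<phi> f + mps_map \<phi> g"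
  by (rule mps_eqI) (simp add: mps_map.rep_eq plus_mps.rep_eq assms)

text \<open>Coefficients of a product are finite sums of products, so a derivation of the
  coefficient ring lifts; this covers the derivative in \<lambda>.\<close>

lemma mps_map_derivation:
  fixes f g :: "('v, 'b::comm_ring_1) mps"
  assumes add: "\<And>x y. \<phi> (x + y) = \<phi> x + \<phi> y"
    and mult: "\<And>x y. \<phi> (x * y) = \<phi> x * y + x * \<phi> y"
  shows "mps_map \<phi> (f * g) = mps_map \<phi> f * g + f * mps_map \<phi> g"
proof (rule mps_eqI)
  fix M
  have "\<phi> 0 = 0" using add[of 0 0] by simp
  then have "\<phi> (\<Sum>A\<in>S. h A) = (\<Sum>A\<in>S. \<phi> (h A))" for h :: "'v multiset \<Rightarrow> 'b" and S
    by (induction S rule: infinite_finite_induct) (simp_all add: add)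
  then show "mps_nth (mps_map \<phi> (f * g)) M = mps_nth (mps_map \<phi> f * g + f * mps_map \<phi> g) M"
    by (simp add: mps_map.rep_eq plus_mps.rep_eq times_mps.rep_eq mult sum.distrib)
qed

lemma mps_deriv_add:
  "mps_deriv v (f + g) = mps_deriv v f + mps_deriv v (g :: ('v, 'b::comm_ring_1) mps)"
  by (rule mps_eqI) (simp add: mps_deriv.rep_eq plus_mps.rep_eq distrib_left)

lemma partial_add: "partial a (f + g) = partial a f + partial a g"
proof (cases a)
  case Spectral
  show ?thesis unfolding Spectral partial.simps
    by (rule mps_map_add) (simp add: distrib_left)
next
  case (Time v)
  then show ?thesis by (simp add: mps_deriv_add)
qed

lemma partial_0 [simp]: "partial a 0 = 0"
  using partial_add[of a 0 0] by simp

lemma partial_sum: "partial a (\<Sum>i\<in>A. f i) = (\<Sum>i\<in>A. partial a (f i))"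
  by (induction A rule: infinite_finite_induct) (simp_all add: partial_add)

lemma partial_mult: "partial a (f * g) = partial a f * g + f * partial a g"
proof (cases a)
  case Spectral
  show ?thesis unfolding Spectral partial.simps
    by (rule mps_map_derivation) (simp_all add: algebra_simps)
next
  case (Time v)
  then show ?thesis by (simp add: mps_deriv_mult)
qed

lemma partial_1 [simp]: "partial a 1 = 0"
  using partial_mult[of a 1 1] by simp

lemma partial_power: "partial a (f ^ n) = of_nat n * f ^ (n - 1) * partial a f"
proof (induction n)
  case (Suc n)
  have "f * (of_nat n * f ^ (n - 1) * partial a f) = of_nat n * f ^ n * partial a f"
    by (cases n) (simp_all add: ac_simps)
  then show ?case
    by (simp add: partial_mult Suc.IH distrib_right mult.commute[of "partial a f"])
qed simp

lemma partial_var: "partial a (mps_var v) = (if a = Time v then 1 else 0)"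
proof (cases a)
  case Spectral
  show ?thesis unfolding Spectral
    by (rule mps_eqI) (simp add: mps_map.rep_eq mps_var.rep_eq zero_mps.rep_eq)
next
  case (Time w)
  have "add_mset w M = {#v#} \<longleftrightarrow> M = {#} \<and> w = v" for M by auto
  then show ?thesis unfolding Time
    by (intro mps_eqI) (auto simp: mps_deriv.rep_eq mps_var.rep_eq one_mps.rep_eq zero_mps.rep_eq)
qed


section \<open>Coefficientwise stabilising sequences\<close>

text \<open>Convergence for the discrete topology on coefficients. Products and partial derivatives
  then pass to the limit by finite computations, with no topology on Laurent series.\<close>

definition stabilises :: "(nat \<Rightarrow> ('v, 'b) mps) \<Rightarrow> ('v, 'b) mps \<Rightarrow> bool"
  where "stabilises F S \<longleftrightarrow> (\<forall>M. \<forall>\<^sub>F n in sequentially. mps_nth (F n) M = mps_nth S M)"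

lemma stabilises_unique:
  assumes "stabilises F S" "stabilises F S'"
  shows "S = S'"
proof (rule mps_eqI)
  fix M
  have "\<forall>\<^sub>F n in sequentially. mps_nth S M = mps_nth S' M"
    using assms[unfolded stabilises_def, rule_format, of M] by eventually_elim simp
  then show "mps_nth S M = mps_nth S' M" by simp
qed

lemma stabilises_add:
  assumes "stabilises F S" "stabilises G T"
  shows "stabilises (\<lambda>n. F n + G n) (S + T)"
  unfolding stabilises_def
proof
  fix M
  show "\<forall>\<^sub>F n in sequentially. mps_nth (F n + G n) M = mps_nth (S + T) M"
    using assms[unfolded stabilises_def, rule_format, of M]
    by eventually_elim (simp add: plus_mps.rep_eq)
qed

text \<open>A coefficient of a product involves only the finitely many submultisets of its
  monomial.\<close>

lemma stabilises_mult_right: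
  assumes "stabilises F S"
  shows "stabilises (\<lambda>n. F n * g) (S * g)"
  unfolding stabilises_def
proof
  fix M
  have "\<forall>\<^sub>F n in sequentially. \<forall>A\<in>{A. A \<subseteq># M}. mps_nth (F n) A = mps_nth S A"
    using assms by (intro eventually_ball_finite) (auto simp: finite_submultisets stabilises_def)
  then show "\<forall>\<^sub>F n in sequentially. mps_nth (F n * g) M = mps_nth (S * g) M"
    by eventually_elim (simp add: times_mps.rep_eq)
qed

lemma stabilises_partial:
  assumes "stabilises F S"
  shows "stabilises (\<lambda>n. partial a (F n)) (partial a S)"
  unfolding stabilises_def
proof
  fix M
  show "\<forall>\<^sub>F n in sequentially. mps_nth (partial a (F n)) M = mps_nth (partial a S) M"
  proof (cases a)
    case Spectral
    then show ?thesis using assms[unfolded stabilises_def, rule_format, of M]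
      by (auto elim!: eventually_mono simp: mps_map.rep_eq)
  next
    case (Time v)
    then show ?thesis using assms[unfolded stabilises_def, rule_format, of "add_mset v M"]
      by (auto elim!: eventually_mono simp: mps_deriv.rep_eq)
  qed
qed

lemma eventually_not_in_mset:
  assumes "inj v"
  shows "\<forall>\<^sub>F n in sequentially. v n \<notin># M"
proof -
  have "finite {n. v n \<in># M}"
    using finite_vimageI[OF finite_set_mset assms, of M] by (simp add: vimage_def)
  then show ?thesis
    by (simp add: cofinite_eq_sequentially[symmetric] eventually_cofinite)
qed

text \<open>Whatever \<open>g\<close> is, term \<open>i\<close> reaches only monomials containing
  \<open>v i\<close>, and a monomial contains finitely many variables.\<close>

lemma stabilises_var_sum:
  fixes g :: "nat \<Rightarrow> ('v, 'b::comm_ring_1) mps"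
  assumes "inj v"
  obtains S where "stabilises (\<lambda>n. \<Sum>i<n. mps_var (v i) * g i) S"
proof
  \<comment> \<open>A threshold beyond all variables \<open>v m\<close> occurring in
    \<open>M\<close>; later terms contribute nothing to this coefficient.\<close>
  define L where "L M = (LEAST n. \<forall>m\<ge>n. v m \<notin># M)" for M
  have L: "v m \<notin># M" if "L M \<le> m" for m M
  proof -
    obtain n where "\<forall>m\<ge>n. v m \<notin># M"
      using eventually_not_in_mset[OF assms, of M] by (auto simp: eventually_sequentially)
    then have "\<forall>m\<ge>L M. v m \<notin># M" unfolding L_def by (rule LeastI)
    with that show ?thesis by blast
  qed
  define S where "S = Abs_mps (\<lambda>M. mps_nth (\<Sum>i<L M. mps_var (v i) * g i) M)"
  have S: "mps_nth S M = mps_nth (\<Sum>i<L M. mps_var (v i) * g i) M" for M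
    unfolding S_def by (simp add: Abs_mps_inverse)
  show "stabilises (\<lambda>n. \<Sum>i<n. mps_var (v i) * g i) S"
    unfolding stabilises_def
  proof
    fix M
    have "mps_nth (\<Sum>i<n. mps_var (v i) * g i) M = mps_nth S M" if "L M \<le> n" for n
      unfolding S mps_nth_sum
      by (rule sum.mono_neutral_right) (use L that in \<open>auto simp: mps_nth_var_times\<close>)
    then show "\<forall>\<^sub>F n in sequentially.
        mps_nth (\<Sum>i<n. mps_var (v i) * g i) M = mps_nth S M"
      by (auto simp: eventually_sequentially)
  qed
qed

text \<open>Each coefficient receives finitely many nonzero terms, so its partial sums become
  constant; uniqueness of limits identifies the constant.\<close>

lemma mps_sums_var_stabilises:
  fixes g :: "nat \<Rightarrow> ('v, 'a::comm_ring_1 fls) mps"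
  assumes "inj v" and sums: "(\<lambda>n. mps_var (v n) * g n) mps_sums S"
  shows "stabilises (\<lambda>n. \<Sum>i<n. mps_var (v i) * g i) S"
  unfolding stabilises_def
proof
  fix M
  obtain N where N: "\<And>n. n \<ge> N \<Longrightarrow> v n \<notin># M"
    using eventually_not_in_mset[OF assms(1), of M] by (auto simp: eventually_sequentially)
  have const: "(\<Sum>i<n. mps_nth (mps_var (v i) * g i) M)
      = (\<Sum>i<N. mps_nth (mps_var (v i) * g i) M)" if "n \<ge> N" for n
    by (rule sum.mono_neutral_right) (use N that in \<open>auto simp: mps_nth_var_times\<close>)
  have "(\<lambda>n. \<Sum>i<n. mps_nth (mps_var (v i) * g i) M) \<longlonglongrightarrow> mps_nth S M"
    using sums by (simp add: mps_sums_def sums_def)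
  moreover have "(\<lambda>n. \<Sum>i<n. mps_nth (mps_var (v i) * g i) M)
      \<longlonglongrightarrow> (\<Sum>i<N. mps_nth (mps_var (v i) * g i) M)"
    by (rule tendsto_eventually) (use const in \<open>unfold eventually_sequentially, blast\<close>)
  ultimately have "mps_nth S M = (\<Sum>i<N. mps_nth (mps_var (v i) * g i) M)"
    by (rule LIMSEQ_unique)
  with const have "\<forall>n\<ge>N. mps_nth (\<Sum>i<n. mps_var (v i) * g i) M = mps_nth S M"
    unfolding mps_nth_sum by presburger
  then show "\<forall>\<^sub>F n in sequentially.
      mps_nth (\<Sum>i<n. mps_var (v i) * g i) M = mps_nth S M"
    unfolding eventually_sequentially by blast
qed

text \<open>The series \<open>c\<close> is \<open>\<Sum>n. n t\<^sub>n \<Psi>\<^sup>n\<^sup>-\<^sup>1\<close>, the derivative with respect to \<open>\<Psi>\<close> at fixed times.\<close>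

lemma partial_var_series:
  fixes \<Psi> P :: "'a::comm_ring_1 lseries"
  assumes "inj v" and sums: "(\<lambda>n. mps_var (v n) * \<Psi> ^ n) mps_sums P"
  obtains c where "\<And>n. partial (Time (v n)) P = \<Psi> ^ n + c * partial (Time (v n)) \<Psi>"
    and "\<And>a. a \<notin> range (Time \<circ> v) \<Longrightarrow> partial a P = c * partial a \<Psi>"
proof -
  obtain c where c: "stabilises (\<lambda>n. \<Sum>i<n. mps_var (v i) * (of_nat i * \<Psi> ^ (i - 1))) c"
    using stabilises_var_sum[OF assms(1)] .
  \<comment> \<open>The part of the derivative that hits the \<open>i\<close>-th variable itself; as
    \<open>v\<close> is injective, it is present for at most one \<open>i\<close>.\<close>
  define e where "e a i = (if a = Time (v i) then \<Psi> ^ i else 0)" for a i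
  have eq: "partial a P = E + c * partial a \<Psi>" if E: "stabilises (\<lambda>n. \<Sum>i<n. e a i) E" for a E
  proof -
    have "partial a (\<Sum>i<n. mps_var (v i) * \<Psi> ^ i)
        = (\<Sum>i<n. e a i) + (\<Sum>i<n. mps_var (v i) * (of_nat i * \<Psi> ^ (i - 1))) * partial a \<Psi>" for n
      by (auto intro!: sum.cong simp: partial_sum partial_mult partial_power partial_var e_def
          sum_distrib_right sum.distrib[symmetric] mult.assoc)
    with stabilises_partial[OF mps_sums_var_stabilises[OF assms], of a]
    have "stabilises (\<lambda>n. (\<Sum>i<n. e a i)
        + (\<Sum>i<n. mps_var (v i) * (of_nat i * \<Psi> ^ (i - 1))) * partial a \<Psi>) (partial a P)"
      by simp
    with stabilises_add[OF E stabilises_mult_right[OF c]] show ?thesis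
      by (rule stabilises_unique[rotated])
  qed
  show thesis
  proof
    fix n
    have "stabilises (\<lambda>m. \<Sum>i<m. e (Time (v n)) i) (\<Psi> ^ n)"
      unfolding stabilises_def e_def
      by (auto simp: eventually_sequentially inj_eq[OF assms(1)] intro!: exI[of _ "Suc n"])
    then show "partial (Time (v n)) P = \<Psi> ^ n + c * partial (Time (v n)) \<Psi>" by (rule eq)
  next
    fix a assume "a \<notin> range (Time \<circ> v)"
    then have "stabilises (\<lambda>m. \<Sum>i<m. e a i) 0"
      unfolding stabilises_def e_def by (auto simp: image_iff)
    from eq[OF this] show "partial a P = c * partial a \<Psi>" by simp
  qed
qed


section \<open>Decay in the spectral variable\<close>

text \<open>\<open>decays k f\<close> says that \<open>f\<close> contains only powers \<open>\<lambda>\<^sup>m\<close> with \<open>m \<le> -k\<close>.\<close>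

definition decays :: "int \<Rightarrow> 'a::zero lseries \<Rightarrow> bool"
  where "decays k f \<longleftrightarrow> (\<forall>M. \<forall>j<k. fls_nth (mps_nth f M) j = 0)"

definition nonneg_powers :: "'a::zero lseries \<Rightarrow> bool"
  where "nonneg_powers f \<longleftrightarrow> (\<forall>M. \<forall>j>0. fls_nth (mps_nth f M) j = 0)"

lemma decays_mono: "decays l f \<Longrightarrow> k \<le> l \<Longrightarrow> decays k f"
  by (auto simp: decays_def)

lemma decays_0 [simp]: "decays k 0"
  by (simp add: decays_def zero_mps.rep_eq)

lemma decays_1 [simp]: "decays 0 1"
  by (simp add: decays_def one_mps.rep_eq)

lemma decays_add: "decays k f \<Longrightarrow> decays k g \<Longrightarrow> decays k (f + g)"
  for f g :: "'a::comm_ring_1 lseries"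
  by (simp add: decays_def plus_mps.rep_eq)

lemma decays_diff: "decays k f \<Longrightarrow> decays k g \<Longrightarrow> decays k (f - g)"
  for f g :: "'a::comm_ring_1 lseries"
  by (simp add: decays_def minus_mps.rep_eq)

lemma decays_minus: "decays k f \<Longrightarrow> decays k (- f)"
  for f :: "'a::comm_ring_1 lseries"
  by (simp add: decays_def uminus_mps.rep_eq)

lemma decays_mult:
  fixes f g :: "'a::comm_ring_1 lseries"
  assumes "decays k f" "decays l g"
  shows "decays (k + l) (f * g)"
proof -
  have "fls_nth (x * y) j = 0"
    if "\<forall>i<k. fls_nth x i = 0" "\<forall>i<l. fls_nth y i = 0" "j < k + l" for x y :: "'a fls" and j
    unfolding fls_times_nth(2)
  proof (intro sum.neutral ballI)
    fix i
    show "fls_nth x i * fls_nth y (j - i) = 0"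
      using that by (cases "i < k") auto
  qed
  with assms show ?thesis
    by (simp add: decays_def times_mps.rep_eq fls_nth_sum sum.neutral)
qed

lemma decays_mult':
  "decays k f \<Longrightarrow> decays l g \<Longrightarrow> m \<le> k + l \<Longrightarrow> decays m (f * g)"
  for f g :: "'a::comm_ring_1 lseries"
  using decays_mono decays_mult by blast

lemma decays_power: "decays 1 f \<Longrightarrow> decays (int n) (f ^ n)"
  for f :: "'a::comm_ring_1 lseries"
  by (induction n) (auto intro: decays_mult')

text \<open>Differentiation in \<lambda> even gains one power, while time derivatives leave the
  powers of \<lambda> alone; \<open>k\<close> is the common bound.\<close>

lemma decays_partial:
  assumes "decays k f"
  shows "decays k (partial a f)"
proof (cases a)
  case Spectral
  show ?thesis unfolding Spectral decays_def
    using assms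
    by (auto simp: mps_map.rep_eq fls_X_power_times_conv_shift decays_def)
next
  case (Time v)
  have "fls_nth (of_nat n * x) j = of_nat n * fls_nth x j" for n j and x :: "'a fls"
    by (simp add: fls_of_nat)
  with Time show ?thesis
    using assms by (simp add: decays_def mps_deriv.rep_eq del: of_nat_Suc of_nat_add)
qed

lemma decays_of_times: "decays 0 (of_times f)"
  by (simp add: decays_def of_times_def mps_map.rep_eq)

lemma decays_lam_inv: "decays 1 lam_inv"
  by (simp add: decays_def lam_inv_def mps_const.rep_eq)

lemma lam_mult_lam_inv: "lam * lam_inv = (1 :: 'a::comm_ring_1 lseries)"
  by (rule mps_eqI)
    (simp add: lam_def lam_inv_def mps_nth_const_times mps_const.rep_eq one_mps.rep_eq
      fls_X_inv_times_conv_shift)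

lemma decays_eq_0:
  assumes "\<And>n. decays (int n) f"
  shows "f = 0"
proof (rule mps_eqI, rule fls_eqI)
  fix M j
  \<comment> \<open>The value \<open>nat (j + 1)\<close> exceeds \<open>j\<close> even for negative
    \<open>j\<close>, as \<open>nat\<close> is never below 0.\<close>
  show "fls_nth (mps_nth f M) j = fls_nth (mps_nth 0 M) j"
    using assms[of "nat (j + 1)"] by (simp add: decays_def zero_mps.rep_eq)
qed

text \<open>A nonzero limit coefficient at \<open>j\<close> would keep the subdegree of
  \<open>F n - L\<close> at most \<open>j\<close>, hence the distance at least
  \<open>inverse (2 ^ nat j)\<close> for all \<open>n\<close>.\<close>

lemma fls_LIMSEQ_nth_eq_0:
  fixes L :: "'a::group_add fls"
  assumes lim: "F \<longlonglongrightarrow> L" and zero: "\<And>n. fls_nth (F n) j = 0"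
  shows "fls_nth L j = 0"
proof (rule ccontr)
  assume "fls_nth L j \<noteq> 0"
  then have nz: "fls_nth (F n - L) j \<noteq> 0" for n using zero by simp
  have "inverse (2 ^ nat j) \<le> dist (F n) L" for n
  proof -
    let ?d = "fls_subdegree (F n - L)"
    have "?d \<le> j" using nz by (rule fls_subdegree_leI)
    then have "inverse (2 ^ nat j) \<le> inverse (2 ^ nat ?d :: real)"
      by (intro le_imp_inverse_le power_increasing) auto
    \<comment> \<open>Covers negative subdegrees, where the distance is a positive power of
      2.\<close>
    moreover have "inverse (2 ^ nat j) \<le> (2 :: real) ^ nat (- ?d)"
      by (rule order_trans[of _ 1]) (auto simp: inverse_le_1_iff)
    moreover have "F n \<noteq> L" using nz[of n] by auto
    ultimately show ?thesis by (auto simp: dist_fls_def)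
  qed
  moreover obtain n where "dist (F n) L < inverse (2 ^ nat j)"
    using metric_LIMSEQ_D[OF lim, of "inverse (2 ^ nat j)"] by auto
  ultimately show False by (meson not_less)
qed

lemma mps_sums_decays:
  fixes S :: "'a::comm_ring_1 lseries"
  assumes "f mps_sums S" and "\<And>n. decays k (f n)"
  shows "decays k S"
  unfolding decays_def
proof (intro allI impI)
  fix M j assume "j < k"
  have "(\<lambda>n. \<Sum>i<n. mps_nth (f i) M) \<longlonglongrightarrow> mps_nth S M"
    using assms(1) by (simp add: mps_sums_def sums_def)
  then show "fls_nth (mps_nth S M) j = 0"
    by (rule fls_LIMSEQ_nth_eq_0) (use assms(2) \<open>j < k\<close> in \<open>simp add: fls_nth_sum decays_def\<close>)
qed

text \<open>The geometric series converges because each power of \<open>\<lambda>\<close> meets only finitely many terms.\<close>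

lemma decays_one_minus_unit:
  fixes w :: "'a::comm_ring_1 lseries"
  assumes "decays 1 w"
  obtains g where "decays 0 g" "(1 - w) * g = 1"
proof
  \<comment> \<open>Coefficient \<open>j\<close> of the geometric series, cut off at
    \<open>n = j\<close> because \<open>w ^ n\<close> has no index below \<open>n\<close>. For
    negative \<open>j\<close> only \<open>n = 0\<close> remains, and it contributes 0.\<close>
  define g where
    "g = Abs_mps (\<lambda>M. Abs_fls (\<lambda>j. \<Sum>n\<le>nat j. fls_nth (mps_nth (w ^ n) M) j))"
  have w: "fls_nth (mps_nth (w ^ n) M) j = 0" if "j < int n" for n M j
    using decays_power[OF assms, of n] that by (simp add: decays_def)
  have "(\<Sum>n\<le>nat j. fls_nth (mps_nth (w ^ n) M) j) = 0" if "j < 0" for M j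
    using that by (intro sum.neutral ballI w) auto
  then have g: "fls_nth (mps_nth g M) j = (\<Sum>n\<le>nat j. fls_nth (mps_nth (w ^ n) M) j)" for M j
    by (simp add: g_def Abs_mps_inverse nth_Abs_fls_lower_bound[of 0])
  show g0: "decays 0 g"
    unfolding decays_def g by (intro allI impI sum.neutral ballI w) auto
  have rest: "decays (int N) (g - (\<Sum>n<N. w ^ n))" for N
    unfolding decays_def
  proof (intro allI impI)
    fix M j assume "j < int N"
    have "(\<Sum>n<N. fls_nth (mps_nth (w ^ n) M) j) = (\<Sum>n\<le>nat j. fls_nth (mps_nth (w ^ n) M) j)"
    proof (cases "j < 0")
      case True
      then have "fls_nth (mps_nth (w ^ n) M) j = 0" for n by (intro w) auto
      then show ?thesis by simp
    next
      case False
      with \<open>j < int N\<close> show ?thesis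
        by (intro sum.mono_neutral_right ballI w) auto
    qed
    then show "fls_nth (mps_nth (g - (\<Sum>n<N. w ^ n)) M) j = 0"
      by (simp add: minus_mps.rep_eq g mps_nth_sum fls_nth_sum)
  qed
  \<comment> \<open>Telescoping with the partial sum leaves an error of order \<open>N\<close> for
    every \<open>N\<close>, hence none.\<close>
  have "decays (int N) ((1 - w) * g - 1)" for N
  proof -
    have "(1 - w) * g - 1 = (1 - w) * (g - (\<Sum>n<N. w ^ n)) - w ^ N"
      using one_diff_power_eq[of w N] by (simp add: algebra_simps)
    moreover have "decays 0 (1 - w)"
      using assms by (intro decays_diff) (auto intro: decays_mono)
    then have "decays (int N) ((1 - w) * (g - (\<Sum>n<N. w ^ n)))"
      using rest by (rule decays_mult') simp
    ultimately show ?thesis using decays_power[OF assms] by (simp add: decays_diff)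
  qed
  then show "(1 - w) * g = 1" using decays_eq_0 by fastforce
qed

lemma ring_inverse_eq: "f * g = 1 \<Longrightarrow> ring_inverse f = g"
  unfolding ring_inverse_def
  by (rule the_equality) (auto, metis mult.assoc mult.commute mult_1)

text \<open>Factoring \<open>\<Psi> = lam * (1 - w)\<close> with \<open>w\<close> decaying reduces
  inversion to the geometric series; the factor \<open>lam_inv\<close> supplies the decay.\<close>

lemma decays_ring_inverse:
  fixes \<Psi> :: "'a::comm_ring_1 lseries"
  assumes "decays 1 (\<Psi> - lam)"
  shows "decays 1 (ring_inverse \<Psi>)"
proof -
  define w where "w = - (lam_inv * (\<Psi> - lam))"
  have "decays 1 w"
    unfolding w_def using decays_lam_inv assms by (intro decays_minus decays_mult'[of 1 _ 1]) auto
  then obtain g where g: "decays 0 g" "(1 - w) * g = 1" by (rule decays_one_minus_unit)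
  have "\<Psi> = lam * (1 - w)"
  proof -
    have "lam * (1 - w) = lam + lam * lam_inv * (\<Psi> - lam)"
      by (simp add: w_def distrib_left mult.assoc)
    then show ?thesis by (simp add: lam_mult_lam_inv)
  qed
  then have "\<Psi> * (lam_inv * g) = lam * lam_inv * ((1 - w) * g)" by (simp add: ac_simps)
  then have "\<Psi> * (lam_inv * g) = 1" by (simp add: g(2) lam_mult_lam_inv)
  then have "ring_inverse \<Psi> = lam_inv * g" by (rule ring_inverse_eq)
  then show ?thesis using decays_mult'[OF decays_lam_inv g(1)] by simp
qed

section \<open>Series without negative powers of \<lambda>, and the projectors\<close>

lemma nonneg_powers_0 [simp]: "nonneg_powers 0"
  by (simp add: nonneg_powers_def zero_mps.rep_eq)

lemma nonneg_powers_1 [simp]: "nonneg_powers 1"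
  by (simp add: nonneg_powers_def one_mps.rep_eq)

lemma nonneg_powers_add: "nonneg_powers f \<Longrightarrow> nonneg_powers g \<Longrightarrow> nonneg_powers (f + g)"
  for f g :: "'a::comm_ring_1 lseries"
  by (simp add: nonneg_powers_def plus_mps.rep_eq)

lemma nonneg_powers_diff: "nonneg_powers f \<Longrightarrow> nonneg_powers g \<Longrightarrow> nonneg_powers (f - g)"
  for f g :: "'a::comm_ring_1 lseries"
  by (simp add: nonneg_powers_def minus_mps.rep_eq)

lemma nonneg_powers_mult:
  fixes f g :: "'a::comm_ring_1 lseries"
  assumes "nonneg_powers f" "nonneg_powers g"
  shows "nonneg_powers (f * g)"
proof -
  have "fls_nth (x * y) j = 0"
    if "\<forall>i>0. fls_nth x i = 0" "\<forall>i>0. fls_nth y i = 0" "j > 0" for x y :: "'a fls" and j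
    unfolding fls_times_nth(2)
  proof (intro sum.neutral ballI)
    fix i
    show "fls_nth x i * fls_nth y (j - i) = 0"
      using that by (cases "i > 0") auto
  qed
  with assms show ?thesis
    by (simp add: nonneg_powers_def times_mps.rep_eq fls_nth_sum sum.neutral)
qed

lemma nonneg_powers_plus_part [simp]: "nonneg_powers (plus_part f)"
  by (simp add: nonneg_powers_def plus_part_def mps_map.rep_eq fls_lam_nonneg.rep_eq)

lemma minus_part_eq_0_iff: "minus_part f = 0 \<longleftrightarrow> nonneg_powers f"
proof
  assume "minus_part f = 0"
  then have "fls_nth (mps_nth (minus_part f) M) j = 0" for M j
    by (simp add: zero_mps.rep_eq)
  then show "nonneg_powers f"
    unfolding nonneg_powers_def minus_part_def mps_map.rep_eq fls_lam_neg.rep_eq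
    by (metis int_one_le_iff_zero_less)
next
  assume "nonneg_powers f"
  then show "minus_part f = 0"
    by (intro mps_eqI fls_eqI)
      (simp add: nonneg_powers_def minus_part_def mps_map.rep_eq fls_lam_neg.rep_eq zero_mps.rep_eq)
qed

text \<open>The splitting into nonnegative and negative powers is unique. This recognises a
  component of the three-form as a projected entry of the evolution equations.\<close>

lemma plus_part_eqI:
  fixes f g :: "'a::comm_ring_1 lseries"
  assumes "nonneg_powers f" and "decays 1 (f - g)"
  shows "plus_part g = f"
proof (intro mps_eqI fls_eqI)
  fix M j
  show "fls_nth (mps_nth (plus_part g) M) j = fls_nth (mps_nth f M) j"
    using assms by (auto simp: nonneg_powers_def decays_def plus_part_def mps_map.rep_eq
        fls_lam_nonneg.rep_eq minus_mps.rep_eq)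
qed

lemma nonneg_decays_eq:
  fixes f g :: "'a::comm_ring_1 lseries"
  assumes "nonneg_powers f" "nonneg_powers g" "decays 1 (f - g)"
  shows "f = g"
  using plus_part_eqI[OF assms(1,3)] plus_part_eqI[OF assms(2), of g] by simp


section \<open>Three by three matrices and three-forms\<close>

no_notation fps_nth (infixl "$" 75)

text \<open>The type \<open>3\<close> is arithmetic modulo 3, so facts about the indices 1, 2, 3
  become facts about 0, 1, 2.\<close>

lemma numeral_mod_3: "(3 :: 3) = 0" "(4 :: 3) = 1" "(1 :: 3) + 1 = 2" "(1 :: 3) + 2 = 0"
  "(2 :: 3) + 1 = 0" "(2 :: 3) + 2 = 1"
  by simp_all

lemma forall_index_3: "(\<forall>i :: 3. P i) \<longleftrightarrow> P 0 \<and> P 1 \<and> P 2"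
  using forall_3[of P] numeral_mod_3(1) by auto

lemma sum_index_3: "(\<Sum>i\<in>UNIV. f i) = f 0 + f 1 + f (2 :: 3)"
  using sum_3[of f] numeral_mod_3(1) by (simp add: ac_simps)

lemma det_index_3:
  "det (A :: 'a::comm_ring_1 ^ 3 ^ 3) =
    A $ 0 $ 0 * (A $ 1 $ 1 * A $ 2 $ 2 - A $ 1 $ 2 * A $ 2 $ 1)
    - A $ 0 $ 1 * (A $ 1 $ 0 * A $ 2 $ 2 - A $ 1 $ 2 * A $ 2 $ 0)
    + A $ 0 $ 2 * (A $ 1 $ 0 * A $ 2 $ 1 - A $ 1 $ 1 * A $ 2 $ 0)"
  unfolding det_3 numeral_mod_3(1) by (simp add: algebra_simps)

text \<open>\<open>matrix_inv\<close> is a Hilbert choice; two-sided inverses are unique, so an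
  explicit one is the chosen one.\<close>

lemma matrix_inv_eq:
  fixes A B :: "'a::comm_ring_1 ^ 'n ^ 'n"
  assumes "A ** B = mat 1" "B ** A = mat 1"
  shows "matrix_inv A = B"
proof -
  let ?C = "matrix_inv A"
  have "A ** ?C = mat 1 \<and> ?C ** A = mat 1"
    unfolding matrix_inv_def by (rule someI[of _ B]) (use assms in simp)
  then have "?C = B ** A ** ?C" using assms by simp
  also have "\<dots> = B"
    using \<open>A ** ?C = mat 1 \<and> ?C ** A = mat 1\<close> by (simp flip: matrix_mul_assoc)
  finally show ?thesis .
qed

text \<open>With indices modulo 3 the cofactors carry no signs.\<close>

lemma matrix_inv_index_3:
  fixes A :: "'a::comm_ring_1 ^ 3 ^ 3"
  assumes "det A = 1"
  shows "matrix_inv A $ j $ i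
    = A $ (i + 1) $ (j + 1) * A $ (i + 2) $ (j + 2) - A $ (i + 1) $ (j + 2) * A $ (i + 2) $ (j + 1)"
proof -
  define B where "B = (\<chi> j i. A $ (i + 1) $ (j + 1) * A $ (i + 2) $ (j + 2)
    - A $ (i + 1) $ (j + 2) * A $ (i + 2) $ (j + 1))"
  \<comment> \<open>Diagonal entries are Laplace expansions of the determinant; off-diagonal ones
    expand a determinant with two equal rows.\<close>
  have "\<forall>i j. (A ** B) $ i $ j = (if i = j then det A else 0)"
    unfolding forall_index_3 matrix_matrix_mult_def B_def det_index_3
    by (simp add: sum_index_3 numeral_mod_3 algebra_simps)
  moreover have "\<forall>i j. (B ** A) $ i $ j = (if i = j then det A else 0)"
    unfolding forall_index_3 matrix_matrix_mult_def B_def det_index_3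
    by (simp add: sum_index_3 numeral_mod_3 algebra_simps)
  ultimately have "A ** B = mat 1" "B ** A = mat 1"
    by (simp_all add: assms vec_eq_iff mat_def)
  then have "matrix_inv A = B" by (rule matrix_inv_eq)
  then show ?thesis by (simp add: B_def)
qed

text \<open>This is a 3 by 3 determinant expanded along the slot \<open>a\<close> with cyclic
  cofactors, so the rules below are rules for determinants.\<close>

lemma wedge_apply:
  "wedge21 (wedge11 f g) h a b c
     = f a * (g b * h c - g c * h b) + g a * (h b * f c - h c * f b) + h a * (f b * g c - f c * g b)"
  by (simp add: wedge11_def wedge21_def algebra_simps)

lemma wedge_rotate: "wedge21 (wedge11 f g) h b c a = wedge21 (wedge11 f g) h a b c"
  by (simp add: wedge_apply algebra_simps)

text \<open>Subtracting multiples of one row from the others preserves a determinant.\<close>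

lemma wedge_shear:
  assumes "\<And>a. g' a = g a - p * f a" "\<And>a. h' a = h a - q * f a"
  shows "wedge21 (wedge11 f g) h = wedge21 (wedge11 f g') h'"
  by (intro ext) (simp add: wedge_apply assms algebra_simps)

text \<open>The 4 by 4 determinant with rows \<open>f\<close>, \<open>g\<close>, \<open>h\<close>,
  \<open>k\<close> and columns \<open>a\<close>, \<open>s\<close>, \<open>x\<close>,
  \<open>y\<close> has a repeated row; expanding it along \<open>k\<close> gives the
  identity.\<close>

lemma wedge_cramer:
  assumes "k \<in> {f, g, h}"
  shows "wedge21 (wedge11 f g) h s x y * k a
     = wedge21 (wedge11 f g) h a x y * k s + wedge21 (wedge11 f g) h a y s * k x
       + wedge21 (wedge11 f g) h a s x * k y"
  using assms by (auto simp: wedge_apply algebra_simps)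

text \<open>The linearity is in the coordinate slot: all three one-forms expand at \<open>a\<close>
  with the same weights.\<close>

lemma wedge_linear:
  assumes "\<And>k. k \<in> {f, g, h} \<Longrightarrow> k a = (\<Sum>i\<in>I. w i * k (z i))"
  shows "wedge21 (wedge11 f g) h a b c = (\<Sum>i\<in>I. w i * wedge21 (wedge11 f g) h (z i) b c)"
  by (simp add: wedge_apply assms sum_distrib_left sum.distrib sum_subtractf algebra_simps)


section \<open>The Jacobian matrix and the evolution equations\<close>

lemma base_coordinate_simps [simp]:
  "base_coordinate 0 = Spectral" "base_coordinate 1 = Time (T1 0)" "base_coordinate 2 = Time (T2 0)"
  by (simp_all add: base_coordinate_def)

lemma det_jacobi_matrix:
  "det (jacobi_matrix \<Psi>)
     = wedge21 (wedge11 (differential (\<Psi> $ 0)) (differential (\<Psi> $ 1))) (differential (\<Psi> $ 2))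
         Spectral (Time (T1 0)) (Time (T2 0))"
  by (simp add: det_index_3 jacobi_matrix_def wedge_apply differential_def algebra_simps
      del: partial.simps)

lemma partial_lam: "partial a lam = (if a = Spectral then 1 else 0)"
proof (cases a)
  case Spectral
  have "- (fls_X ^ 2 * fls_deriv fls_X_inv) = (1 :: 'a fls)"
    by (rule fls_eqI) (simp add: fls_X_power_times_conv_shift)
  then show ?thesis unfolding Spectral lam_def
    by (intro mps_eqI) (simp add: mps_map.rep_eq mps_const.rep_eq one_mps.rep_eq)
next
  case (Time v)
  then show ?thesis unfolding lam_def
    by (intro mps_eqI) (simp add: mps_deriv.rep_eq mps_const.rep_eq zero_mps.rep_eq)
qed

lemma decays_partial_lam:
  assumes "decays 1 (\<Psi> - lam)"
  shows "decays 1 (partial a \<Psi> - (if a = Spectral then 1 else 0))"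
proof -
  have "partial a \<Psi> = partial a (\<Psi> - lam) + partial a lam"
    by (simp flip: partial_add)
  then have "partial a \<Psi> - (if a = Spectral then 1 else 0) = partial a (\<Psi> - lam)"
    by (simp add: partial_lam)
  then show ?thesis using decays_partial[OF assms] by simp
qed

text \<open>The tail \<open>N\<close> and its derivatives have only negative powers, so
  \<open>P\<close> alone matters. No decay is known for \<open>c\<close>, but it multiplies
  derivatives of \<open>\<Psi>\<close> and will be removed by \<open>wedge_shear\<close>.\<close>

lemma decays_partial_var_series:
  fixes \<Psi> P N :: "'a::comm_ring_1 lseries"
  assumes "inj v" "(\<lambda>n. mps_var (v n) * \<Psi> ^ n) mps_sums P" and \<Psi>: "decays 1 (\<Psi> - lam)"
    and N: "(\<lambda>n. of_times (\<psi> (Suc n)) * ring_inverse \<Psi> ^ Suc n) mps_sums N"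
  obtains c where
    "\<And>n. decays 1 (partial (Time (v n)) (P + N) - c * partial (Time (v n)) \<Psi> - \<Psi> ^ n)"
    and "\<And>a. a \<notin> range (Time \<circ> v) \<Longrightarrow> decays 1 (partial a (P + N) - c * partial a \<Psi>)"
proof -
  have "decays 1 (of_times (\<psi> (Suc n)) * ring_inverse \<Psi> ^ Suc n)" for n
    using decays_of_times decays_power[OF decays_ring_inverse[OF \<Psi>], of "Suc n"]
    by (rule decays_mult') simp
  with N have "decays 1 N" by (rule mps_sums_decays)
  then have "decays 1 (partial a N)" for a by (rule decays_partial)
  moreover obtain c where "\<And>n. partial (Time (v n)) P = \<Psi> ^ n + c * partial (Time (v n)) \<Psi>"
    "\<And>a. a \<notin> range (Time \<circ> v) \<Longrightarrow> partial a P = c * partial a \<Psi>"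
    using partial_var_series[OF assms(1,2)] by metis
  ultimately show thesis by (intro that[of c]) (simp_all add: partial_add del: partial.simps)
qed

lemma partial_vec_eq_iff:
  "partial_vec a \<Psi> = (\<Sum>i\<in>UNIV. w i *s partial_vec (base_coordinate i) \<Psi>)
     \<longleftrightarrow> (\<forall>k. differential (\<Psi> $ k) a = (\<Sum>i\<in>UNIV. w i * differential (\<Psi> $ k) (base_coordinate i)))"
  by (simp add: vec_eq_iff partial_vec_def differential_def sum_component)

text \<open>The evolution equations expand every partial derivative in \<open>\<partial>\<^sub>0, \<partial>\<^sub>1, \<partial>\<^sub>2\<close> with coefficients
  free of negative powers of \<open>\<lambda>\<close>; by trilinearity all components of the three-form are then
  combinations of the single component \<open>det J\<close>.\<close>

lemma nonneg_powers_wedge: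
  fixes f g h :: "'a::comm_ring_1 form1"
  defines "\<Omega> \<equiv> wedge21 (wedge11 f g) h"
  assumes base: "nonneg_powers (\<Omega> Spectral (Time (T1 0)) (Time (T2 0)))"
    and expand: "\<And>a. \<exists>w. (\<forall>i. nonneg_powers (w i)) \<and>
      (\<forall>k\<in>{f, g, h}. k a = (\<Sum>i\<in>UNIV. w i * k (base_coordinate i)))"
  shows "nonneg_powers (\<Omega> a b c)"
proof -
  have rotate: "\<Omega> b c a = \<Omega> a b c" for a b c
    unfolding \<Omega>_def by (rule wedge_rotate)
  have swap: "\<Omega> a c b = - \<Omega> a b c" and alternate: "\<Omega> a b b = 0" for a b c
    by (simp_all add: \<Omega>_def wedge_apply algebra_simps)
  have neg: "nonneg_powers (- x)" if "nonneg_powers x" for x :: "'a lseries"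
    using nonneg_powers_diff[OF nonneg_powers_0 that] by simp
  have step: "nonneg_powers (\<Omega> a b c)"
    if "\<And>i. nonneg_powers (\<Omega> (base_coordinate i) b c)" for a b c
  proof -
    from expand[of a] obtain w where w: "\<And>i. nonneg_powers (w i)"
      and "\<And>k. k \<in> {f, g, h} \<Longrightarrow> k a = (\<Sum>i\<in>UNIV. w i * k (base_coordinate i))" by blast
    then have "\<Omega> a b c = (\<Sum>i\<in>UNIV. w i * \<Omega> (base_coordinate i) b c)"
      unfolding \<Omega>_def by (intro wedge_linear) blast
    then show ?thesis
      using w that by (simp add: sum_index_3 nonneg_powers_add nonneg_powers_mult
          del: base_coordinate_simps)
  qed
  \<comment> \<open>A repeated coordinate gives zero; distinct ones give the component in
    \<open>base\<close> up to sign.\<close>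
  have base': "\<forall>i j k. nonneg_powers (\<Omega> (base_coordinate i) (base_coordinate j) (base_coordinate k))"
  proof -
    let ?s = Spectral and ?x = "Time (T1 0)" and ?y = "Time (T2 0)"
    have [simp]: "\<Omega> b a b = 0" "\<Omega> b b a = 0" for a b
      using rotate[of b a b] rotate[of a b b] alternate by simp_all
    have "nonneg_powers (\<Omega> ?s ?x ?y)" "nonneg_powers (\<Omega> ?x ?y ?s)" "nonneg_powers (\<Omega> ?y ?s ?x)"
      using base rotate[of ?x ?y ?s] rotate[of ?s ?x ?y] by simp_all
    moreover from this have "nonneg_powers (\<Omega> ?s ?y ?x)" "nonneg_powers (\<Omega> ?x ?s ?y)"
      "nonneg_powers (\<Omega> ?y ?x ?s)"
      using swap[of ?s ?y ?x] swap[of ?x ?s ?y] swap[of ?y ?x ?s] neg by simp_all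
    ultimately show ?thesis by (simp add: forall_index_3 alternate)
  qed
  \<comment> \<open>Only the first slot can be expanded, so the slots are rotated cyclically and
    freed one after another.\<close>
  have "nonneg_powers (\<Omega> a (base_coordinate j) (base_coordinate k))" for a j k
    by (rule step) (use base' in blast)
  then have "nonneg_powers (\<Omega> (base_coordinate j) (base_coordinate k) a)" for a j k
    by (subst rotate)
  then have "nonneg_powers (\<Omega> b (base_coordinate k) a)" for a b k
    by (rule step)
  then have "nonneg_powers (\<Omega> (base_coordinate k) a b)" for a b k
    by (subst rotate)
  then show ?thesis by (rule step)
qed

theorem proposition2:
  fixes \<Psi> :: "'a::field_char_0 lseries ^ 3"
    and \<psi>0 \<psi>1 \<psi>2 :: "nat \<Rightarrow> 'a times_series"
    and P1 N1 P2 N2 :: "'a lseries"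
  assumes \<Psi>0: "(\<lambda>n. of_times (\<psi>0 (Suc n)) * lam_inv ^ Suc n) mps_sums (\<Psi> $ 0 - lam)"
    and P1: "(\<lambda>n. mps_var (T1 n) * (\<Psi> $ 0) ^ n) mps_sums P1"
    and N1: "(\<lambda>n. of_times (\<psi>1 (Suc n)) * ring_inverse (\<Psi> $ 0) ^ Suc n) mps_sums N1"
    and \<Psi>1: "\<Psi> $ 1 = P1 + N1"
    and P2: "(\<lambda>n. mps_var (T2 n) * (\<Psi> $ 0) ^ n) mps_sums P2"
    and N2: "(\<lambda>n. of_times (\<psi>2 (Suc n)) * ring_inverse (\<Psi> $ 0) ^ Suc n) mps_sums N2"
    and \<Psi>2: "\<Psi> $ 2 = P2 + N2"
  shows "minus_part_form3 (wedge21 (wedge11 (differential (\<Psi> $ 0)) (differential (\<Psi> $ 1)))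
             (differential (\<Psi> $ 2))) = (\<lambda>a b c. 0)
     \<longleftrightarrow>
       (\<forall>n. partial_vec (Time (T1 n)) \<Psi> =
          (\<Sum>i\<in>UNIV. plus_part (matrix_inv (jacobi_matrix \<Psi>) $ 1 $ i * (\<Psi> $ 0) ^ n)
             *s partial_vec (base_coordinate i) \<Psi>)) \<and>
       (\<forall>n. partial_vec (Time (T2 n)) \<Psi> =
          (\<Sum>i\<in>UNIV. plus_part (matrix_inv (jacobi_matrix \<Psi>) $ 2 $ i * (\<Psi> $ 0) ^ n)
             *s partial_vec (base_coordinate i) \<Psi>)) \<and>
       det (jacobi_matrix \<Psi>) = 1"
proof -
  define X where "X k = differential (\<Psi> $ k)" for k
  define \<Omega> where "\<Omega> = wedge21 (wedge11 (X 0) (X 1)) (X 2)"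
  let ?K = "matrix_inv (jacobi_matrix \<Psi>)"
  let ?s = Spectral and ?x = "Time (T1 0)" and ?y = "Time (T2 0)"
  have X_partial: "X k a = partial a (\<Psi> $ k)" for k a
    by (simp add: X_def differential_def)
  have det: "det (jacobi_matrix \<Psi>) = \<Omega> ?s ?x ?y"
    by (simp add: det_jacobi_matrix \<Omega>_def X_def)
  have "decays 1 (of_times (\<psi>0 (Suc n)) * lam_inv ^ Suc n)" for n
    using decays_of_times decays_power[OF decays_lam_inv, of "Suc n"] by (rule decays_mult') simp
  with \<Psi>0 have lam: "decays 1 (\<Psi> $ 0 - lam)" by (rule mps_sums_decays)
  have X0: "decays 1 (X 0 ?s - 1)" "decays 1 (X 0 (Time v))" for v
    using decays_partial_lam[OF lam, of ?s] decays_partial_lam[OF lam, of "Time v"]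
    by (simp_all add: X_partial del: partial.simps)
  have inj: "inj T1" "inj T2" by (auto intro: injI)
  obtain c1 where c1: "\<And>n. decays 1 (X 1 (Time (T1 n)) - c1 * X 0 (Time (T1 n)) - (\<Psi> $ 0) ^ n)"
    "\<And>a. a \<notin> range (Time \<circ> T1) \<Longrightarrow> decays 1 (X 1 a - c1 * X 0 a)"
    using decays_partial_var_series[OF inj(1) P1 lam N1] unfolding X_partial \<Psi>1 by metis
  obtain c2 where c2: "\<And>n. decays 1 (X 2 (Time (T2 n)) - c2 * X 0 (Time (T2 n)) - (\<Psi> $ 0) ^ n)"
    "\<And>a. a \<notin> range (Time \<circ> T2) \<Longrightarrow> decays 1 (X 2 a - c2 * X 0 a)"
    using decays_partial_var_series[OF inj(2) P2 lam N2] unfolding X_partial \<Psi>2 by metis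
  \<comment> \<open>The differentials of \<open>\<Psi> $ 1\<close> and \<open>\<Psi> $ 2\<close>
    reduced modulo that of \<open>\<Psi> $ 0\<close>. Up to negative powers, \<open>Y1\<close> has
    only the components \<open>(\<Psi> $ 0) ^ n\<close> at \<open>T1 n\<close>, and
    \<open>Y2\<close> only those at \<open>T2 n\<close>.\<close>
  define Y1 where "Y1 a = X 1 a - c1 * X 0 a" for a
  define Y2 where "Y2 a = X 2 a - c2 * X 0 a" for a
  have Y1: "decays 1 (Y1 (Time (T1 n)) - (\<Psi> $ 0) ^ n)" "decays 1 (Y1 ?s)"
    "decays 1 (Y1 (Time (T2 n)))" for n
    unfolding Y1_def by (auto intro!: c1)
  have Y2: "decays 1 (Y2 (Time (T2 n)) - (\<Psi> $ 0) ^ n)" "decays 1 (Y2 ?s)"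
    "decays 1 (Y2 (Time (T1 n)))" for n
    unfolding Y2_def by (auto intro!: c2)
  have \<Omega>_Y: "\<Omega> = wedge21 (wedge11 (X 0) Y1) Y2"
    unfolding \<Omega>_def by (rule wedge_shear) (simp_all add: Y1_def Y2_def)
  \<comment> \<open>The case \<open>n = 0\<close>, where the power of \<open>\<Psi> $ 0\<close> is
    1.\<close>
  have base: "decays 1 (Y1 ?x - 1)" "decays 1 (Y1 ?y)" "decays 1 (Y2 ?x)" "decays 1 (Y2 ?y - 1)"
    using Y1(1,3)[of 0] Y2(1,3)[of 0] by simp_all
  have decays_0: "decays 0 f" if "decays 1 f" for f :: "'a lseries"
    using that by (rule decays_mono) simp
  have decays_0': "decays 0 f" if "decays 1 (f - 1)" for f :: "'a lseries"
    using decays_add[OF decays_0[OF that] decays_1] by simp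
  have "\<forall>i. decays 0 (X 0 (base_coordinate i)) \<and> decays 0 (Y1 (base_coordinate i))
      \<and> decays 0 (Y2 (base_coordinate i))"
    using X0 Y1(2) Y2(2) base by (simp add: forall_index_3 decays_0 decays_0')
  then have entries: "decays 0 (X 0 (base_coordinate i))" "decays 0 (Y1 (base_coordinate i))"
    "decays 0 (Y2 (base_coordinate i))" for i by blast+
  have mult0: "decays 0 (f * g)" if "decays 0 f" "decays 0 g" for f g :: "'a lseries"
    using that by (rule decays_mult') simp
  have mult1: "decays 1 (f * g)" if "decays 1 f" "decays 0 g" for f g :: "'a lseries"
    using that by (rule decays_mult') simp
  \<comment> \<open>On the base coordinates \<open>X 0\<close>, \<open>Y1\<close>, \<open>Y2\<close>
    form the identity matrix modulo negative powers. Each summand below has one decaying factor and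
    otherwise bounded ones.\<close>
  have det_1: "decays 1 (\<Omega> ?s ?x ?y - 1)"
  proof -
    have "\<Omega> ?s ?x ?y - 1 = (X 0 ?s - 1) * (Y1 ?x * Y2 ?y) + (Y1 ?x - 1) * Y2 ?y + (Y2 ?y - 1)
        - Y1 ?y * (X 0 ?s * Y2 ?x)
        + Y1 ?s * (Y2 ?x * X 0 ?y - Y2 ?y * X 0 ?x) + Y2 ?s * (X 0 ?x * Y1 ?y - X 0 ?y * Y1 ?x)"
      by (simp add: \<Omega>_Y wedge_apply algebra_simps)
    then show ?thesis
      using X0(1) Y1(2) Y2(2) base entries[of 0] entries[of 1] entries[of 2]
      by (simp only: base_coordinate_simps decays_add decays_diff mult0 mult1)
  qed
  \<comment> \<open>Along the time slot only \<open>Y1\<close> (respectively \<open>Y2\<close>)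
    survives modulo negative powers, as a power of \<open>\<Psi> $ 0\<close>. Its cofactor is
    bounded at base coordinates and unchanged when the other \<open>Y\<close> is replaced by its
    \<open>X\<close>.\<close>
  have cofactor_1: "decays 1 (\<Omega> (Time (T1 n)) b c - (X 2 b * X 0 c - X 0 b * X 2 c) * (\<Psi> $ 0) ^ n)"
    and cofactor_2: "decays 1 (\<Omega> (Time (T2 n)) b c - (X 0 b * X 1 c - X 1 b * X 0 c) * (\<Psi> $ 0) ^ n)"
    if "b \<in> range base_coordinate" "c \<in> range base_coordinate" for n b c
  proof -
    have bc: "decays 0 (X 0 b)" "decays 0 (X 0 c)" "decays 0 (Y1 b)" "decays 0 (Y1 c)"
      "decays 0 (Y2 b)" "decays 0 (Y2 c)"
      using that entries by auto
    let ?a = "Time (T1 n)"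
    have "\<Omega> ?a b c - (X 2 b * X 0 c - X 0 b * X 2 c) * (\<Psi> $ 0) ^ n
        = X 0 ?a * (Y1 b * Y2 c - Y1 c * Y2 b) + (Y1 ?a - (\<Psi> $ 0) ^ n) * (Y2 b * X 0 c - Y2 c * X 0 b)
          + Y2 ?a * (X 0 b * Y1 c - X 0 c * Y1 b)"
      unfolding \<Omega>_Y wedge_apply by (simp add: Y2_def algebra_simps)
    then show "decays 1 (\<Omega> ?a b c - (X 2 b * X 0 c - X 0 b * X 2 c) * (\<Psi> $ 0) ^ n)"
      using X0(2) Y1(1) Y2(3) bc by (simp only: decays_add decays_diff mult0 mult1)
    let ?a = "Time (T2 n)"
    have "\<Omega> ?a b c - (X 0 b * X 1 c - X 1 b * X 0 c) * (\<Psi> $ 0) ^ n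
        = X 0 ?a * (Y1 b * Y2 c - Y1 c * Y2 b) + Y1 ?a * (Y2 b * X 0 c - Y2 c * X 0 b)
          + (Y2 ?a - (\<Psi> $ 0) ^ n) * (X 0 b * Y1 c - X 0 c * Y1 b)"
      unfolding \<Omega>_Y wedge_apply by (simp add: Y1_def algebra_simps)
    then show "decays 1 (\<Omega> ?a b c - (X 0 b * X 1 c - X 1 b * X 0 c) * (\<Psi> $ 0) ^ n)"
      using X0(2) Y1(3) Y2(1) bc by (simp only: decays_add decays_diff mult0 mult1)
  qed
  have "minus_part_form3 \<Omega> = (\<lambda>a b c. 0) \<longleftrightarrow> (\<forall>a b c. nonneg_powers (\<Omega> a b c))"
    by (simp add: minus_part_form3_def fun_eq_iff minus_part_eq_0_iff)
  also have "\<dots> \<longleftrightarrow>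
      (\<forall>n k. X k (Time (T1 n))
         = (\<Sum>i\<in>UNIV. plus_part (?K $ 1 $ i * (\<Psi> $ 0) ^ n) * X k (base_coordinate i))) \<and>
      (\<forall>n k. X k (Time (T2 n))
         = (\<Sum>i\<in>UNIV. plus_part (?K $ 2 $ i * (\<Psi> $ 0) ^ n) * X k (base_coordinate i))) \<and>
      \<Omega> ?s ?x ?y = 1" (is "_ \<longleftrightarrow> ?E1 \<and> ?E2 \<and> ?D")
  proof
    assume nonneg: "\<forall>a b c. nonneg_powers (\<Omega> a b c)"
    have D: ?D
      using nonneg det_1 by (intro nonneg_decays_eq) auto
    \<comment> \<open>The Cramer numerator: base coordinate \<open>i\<close> is replaced by
      \<open>a\<close> and rotated to the front, which costs no sign.\<close>
    define w where "w a i = \<Omega> a (base_coordinate (i + 1)) (base_coordinate (i + 2))" for a i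
    have cramer: "X k a = (\<Sum>i\<in>UNIV. w a i * X k (base_coordinate i))" for k a
    proof -
      have "\<forall>k. X k \<in> {X 0, X 1, X 2}" by (simp add: forall_index_3)
      then have "\<Omega> ?s ?x ?y * X k a = \<Omega> a ?x ?y * X k ?s + \<Omega> a ?y ?s * X k ?x + \<Omega> a ?s ?x * X k ?y"
        unfolding \<Omega>_def by (intro wedge_cramer) blast
      with D show ?thesis by (simp add: sum_index_3 w_def numeral_mod_3)
    qed
    have K: "?K $ j $ i = X (j + 1) (base_coordinate (i + 1)) * X (j + 2) (base_coordinate (i + 2))
        - X (j + 2) (base_coordinate (i + 1)) * X (j + 1) (base_coordinate (i + 2))" for i j
    proof -
      have "jacobi_matrix \<Psi> $ i $ k = X k (base_coordinate i)" for i k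
        by (simp add: jacobi_matrix_def X_partial)
      moreover have "det (jacobi_matrix \<Psi>) = 1" using D det by simp
      ultimately show ?thesis by (simp only: matrix_inv_index_3)
    qed
    \<comment> \<open>By hypothesis \<open>w\<close> has no negative powers, and by
      \<open>cofactor_1\<close> it differs from the unprojected product by negative powers
      only.\<close>
    have plus_1: "plus_part (?K $ 1 $ i * (\<Psi> $ 0) ^ n) = w (Time (T1 n)) i" for n i
      unfolding K w_def numeral_mod_3 using nonneg by (intro plus_part_eqI cofactor_1) auto
    have plus_2: "plus_part (?K $ 2 $ i * (\<Psi> $ 0) ^ n) = w (Time (T2 n)) i" for n i
      unfolding K w_def numeral_mod_3 using nonneg by (intro plus_part_eqI cofactor_2) auto
    have ?E1 ?E2
      unfolding plus_1 plus_2 by (intro allI cramer)+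
    with D show "?E1 \<and> ?E2 \<and> ?D" by blast
  next
    assume E: "?E1 \<and> ?E2 \<and> ?D"
    have expand: "\<exists>w. (\<forall>i. nonneg_powers (w i)) \<and> (\<forall>k. X k a = (\<Sum>i\<in>UNIV. w i * X k (base_coordinate i)))"
      for a
    proof (cases a)
      case Spectral
      then show ?thesis
        \<comment> \<open>\<lambda> is itself base coordinate 0, so its expansion is
          trivial.\<close>
        by (intro exI[of _ "\<lambda>i. if i = 0 then 1 else 0"]) (simp add: sum_index_3)
    next
      case (Time v)
      show ?thesis
      proof (cases v)
        case (T1 n)
        with Time E show ?thesis
          by (intro exI[of _ "\<lambda>i. plus_part (?K $ 1 $ i * (\<Psi> $ 0) ^ n)"]) simp
      next
        case (T2 n)
        with Time E show ?thesis
          by (intro exI[of _ "\<lambda>i. plus_part (?K $ 2 $ i * (\<Psi> $ 0) ^ n)"]) simp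
      qed
    qed
    show "\<forall>a b c. nonneg_powers (\<Omega> a b c)"
    proof (intro allI)
      fix a b c
      show "nonneg_powers (\<Omega> a b c)"
        unfolding \<Omega>_def
      proof (rule nonneg_powers_wedge)
        show "nonneg_powers (wedge21 (wedge11 (X 0) (X 1)) (X 2) ?s ?x ?y)"
          using E unfolding \<Omega>_def by simp
        show "\<exists>w. (\<forall>i. nonneg_powers (w i)) \<and>
            (\<forall>k\<in>{X 0, X 1, X 2}. k a = (\<Sum>i\<in>UNIV. w i * k (base_coordinate i)))" for a
          using expand[of a] by blast
      qed
    qed
  qed
  finally show ?thesis
    unfolding partial_vec_eq_iff det by (simp only: \<Omega>_def X_def)
qed

end
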